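(* Let $k_1<k_2<\dots<k_n$ be keys (real numbers) with key weights $\beta_1,\dots,\beta_n\ge 0$ and interval weights $\alpha_0,\dots,\alpha_n\ge 0$, and let $\mathcal{S}$ be any valid set (as defined in the context). Fix any key $k_b\in\mathcal{S}$ whose weight $\beta_b$ is largest among the weights of the keys in $\mathcal{S}$. Then among the two-way-comparison trees that handle $\mathcal{S}$, there is one of minimum cost, $T$, that satisfies at least one of the following: (i) $T$ consists of a single leaf; (ii) the root of $T$ performs a less-than comparison $q<k_c$ for some key $k_c$; (iii) the root of $T$ performs an equality test $q=k_b$ to the fixed key $k_b$.
   Context: Setup: keys $k_1<\dots<k_n$; set $k_0=-\infty$, $k_{n+1}=+\infty$ (these are not keys). Key $k_b$ has weight $\beta_b\ge0$ and the open "failure" interval $(k_a,k_{a+1})$, $a=0,\dots,n$, has weight $\alpha_a\ge0$. Valid sets: fix a permutation $\pi$ of $\{1,\dots,n\}$ such that $\beta_{\pi(1)}\le\beta_{\pi(2)}\le\dots\le\beta_{\pi(n)}$ (ties broken arbitrarily). A set $\mathcal{S}$ of possible queries is valid if either $\mathcal{S}=\{k_b\}$ for some key $k_b$, or $\mathcal{S}=\mathcal{S}_{ijh}:=[k_i,k_j)\setminus\{k_{\pi(h+1)},k_{\pi(h+2)},\dots,k_{\pi(n)},k_0\}$ for some $i,j\in\{0,1,\dots,n+1\}$ with $i<j$ and some $h\in\{0,1,\dots,n\}$. Such a set is a union of some keys and some failure intervals $(k_a,k_{a+1})$. Two-way-comparison trees: a rooted binary tree in which every internal node performs either a test $q=k_c$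 or a comparison $q<k_c$ against some key $k_c$, with one child for each outcome, and every leaf is labeled either by a key or by a failure interval. A tree handles $\mathcal{S}$ if its leaves are in one-to-one correspondence with the keys and failure intervals contained in $\mathcal{S}$, and for every query value $q\in\mathcal{S}$, starting at the root and following the outcomes of the comparisons leads to the leaf labeled $k_c$ if $q=k_c$, or to the leaf labeled by the failure interval containing $q$ otherwise. The cost of a tree $T$ is $\sum_{\ell}\mathrm{depth}_T(\ell)\,w(\ell)$ over its leaves $\ell$, where $w(\ell)$ is the weight of the key or interval labeling $\ell$ and the depth is the number of edges from the root to $\ell$. *)

theory Defs
  imports "HOL-Library.Extended_Real" "HOL-Combinatorics.Permutations"
begin

text \<open>
  The keys are the values \<open>k 1, \<dots>, k n\<close> of a function \<open>k :: nat \<Rightarrow> real\<close>; keys are referred to by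
  their index. Queries live in \<^typ>\<open>ereal\<close> only so that the two infinite sentinels can be written
  down; every valid set consists of finite values.
\<close>

definition key :: "(nat \<Rightarrow> real) \<Rightarrow> nat \<Rightarrow> nat \<Rightarrow> ereal" where
  "key k n i = (if i = 0 then - \<infinity> else if i = n + 1 then \<infinity> else ereal (k i))"

definition failure_interval :: "(nat \<Rightarrow> real) \<Rightarrow> nat \<Rightarrow> nat \<Rightarrow> ereal set" where
  "failure_interval k n a = {key k n a <..< key k n (a + 1)}"

definition S_ijh :: "(nat \<Rightarrow> real) \<Rightarrow> nat \<Rightarrow> (nat \<Rightarrow> nat) \<Rightarrow> nat \<Rightarrow> nat \<Rightarrow> nat \<Rightarrow> ereal set" where
  "S_ijh k n \<pi> i j h =
     {key k n i ..< key k n j} - ({key k n (\<pi> m) | m. m \<in> {h + 1..n}} \<union> {key k n 0})"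

definition valid :: "(nat \<Rightarrow> real) \<Rightarrow> nat \<Rightarrow> (nat \<Rightarrow> nat) \<Rightarrow> ereal set \<Rightarrow> bool" where
  "valid k n \<pi> S \<longleftrightarrow>
     (\<exists>b\<in>{1..n}. S = {key k n b}) \<or>
     (\<exists>i\<in>{0..n + 1}. \<exists>j\<in>{0..n + 1}. \<exists>h\<in>{0..n}. i < j \<and> S = S_ijh k n \<pi> i j h)"

datatype label = Key nat | Gap nat  \<comment> \<open>\<open>Gap a\<close> stands for the failure interval \<open>(k\<^sub>a, k\<^sub>a\<^sub>+\<^sub>1)\<close>\<close>

datatype test = Eq_Test nat | Less_Test nat

text \<open>The first subtree of a node is the one for the positive outcome of its test.\<close>

datatype tree = Leaf label | Node test tree tree

fun test_holds :: "(nat \<Rightarrow> real) \<Rightarrow> nat \<Rightarrow> test \<Rightarrow> ereal \<Rightarrow> bool" where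
  "test_holds k n (Eq_Test c) q \<longleftrightarrow> q = key k n c"
| "test_holds k n (Less_Test c) q \<longleftrightarrow> q < key k n c"

fun test_key :: "test \<Rightarrow> nat" where
  "test_key (Eq_Test c) = c"
| "test_key (Less_Test c) = c"

fun two_way_tree :: "nat \<Rightarrow> tree \<Rightarrow> bool" where
  "two_way_tree n (Leaf l) \<longleftrightarrow> l \<in> Key ` {1..n} \<union> Gap ` {0..n}"
| "two_way_tree n (Node t l r) \<longleftrightarrow> test_key t \<in> {1..n} \<and> two_way_tree n l \<and> two_way_tree n r"

fun search :: "(nat \<Rightarrow> real) \<Rightarrow> nat \<Rightarrow> tree \<Rightarrow> ereal \<Rightarrow> label" where
  "search k n (Leaf l) q = l"
| "search k n (Node t l r) q = (if test_holds k n t q then search k n l q else search k n r q)"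

text \<open>The leaves from left to right, each with its label and its depth.\<close>

fun leaves :: "tree \<Rightarrow> (label \<times> nat) list" where
  "leaves (Leaf l) = [(l, 0)]"
| "leaves (Node t l r) = map (\<lambda>(x, d). (x, d + 1)) (leaves l @ leaves r)"

definition labels_of :: "(nat \<Rightarrow> real) \<Rightarrow> nat \<Rightarrow> ereal set \<Rightarrow> label set" where
  "labels_of k n S =
     Key ` {c \<in> {1..n}. key k n c \<in> S} \<union> Gap ` {a \<in> {0..n}. failure_interval k n a \<subseteq> S}"

text \<open>
  The first two conjuncts say that labelling is a bijection from the leaves onto the keys and
  failure intervals contained in \<open>S\<close>.
\<close>

definition handles :: "(nat \<Rightarrow> real) \<Rightarrow> nat \<Rightarrow> tree \<Rightarrow> ereal set \<Rightarrow> bool" where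
  "handles k n T S \<longleftrightarrow>
     distinct (map fst (leaves T)) \<and>
     set (map fst (leaves T)) = labels_of k n S \<and>
     (\<forall>q\<in>S.
        (\<forall>c\<in>{1..n}. q = key k n c \<longrightarrow> search k n T q = Key c) \<and>
        (\<forall>a\<in>{0..n}. q \<in> failure_interval k n a \<longrightarrow> search k n T q = Gap a))"

fun weight :: "(nat \<Rightarrow> real) \<Rightarrow> (nat \<Rightarrow> real) \<Rightarrow> label \<Rightarrow> real" where
  "weight \<alpha> \<beta> (Key b) = \<beta> b"
| "weight \<alpha> \<beta> (Gap a) = \<alpha> a"

definition cost :: "(nat \<Rightarrow> real) \<Rightarrow> (nat \<Rightarrow> real) \<Rightarrow> tree \<Rightarrow> real" where
  "cost \<alpha> \<beta> T = (\<Sum>(l, d)\<leftarrow>leaves T. real d * weight \<alpha> \<beta> l)"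

end

theory Submission imports Defs begin

text \<open>
  Unless the valid set is a single key, it contains the failure interval just above \<open>k\<^sub>b\<close>, and only
  the test \<open>q = k\<^sub>b\<close> separates that interval from \<open>k\<^sub>b\<close>. Hence every tree meets this test on the search
  path of \<open>k\<^sub>b\<close>. In an optimal tree, rotating two adjacent nodes of this path cannot decrease the cost,
  so the weight split off by a test does not increase on the way down; at \<open>q = k\<^sub>b\<close> it equals
  \<open>\<beta>\<^sub>b\<close>, so it is at least \<open>\<beta>\<^sub>b\<close> everywhere above. If the root tests \<open>q = k\<^sub>c\<close> with \<open>c \<noteq> b\<close>, then by
  induction its child may be taken to be a less-than comparison or the test \<open>q = k\<^sub>b\<close>, and since
  \<open>\<beta>\<^sub>c \<le> \<beta>\<^sub>b\<close>, rotating that child to the root does not increase the cost.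
\<close>

section \<open>Tests and trees acting on labels instead of queries\<close>

fun sat :: "test \<Rightarrow> label \<Rightarrow> bool" where
  "sat (Eq_Test c) (Key x) \<longleftrightarrow> x = c"
| "sat (Eq_Test c) (Gap a) \<longleftrightarrow> False"
| "sat (Less_Test c) (Key x) \<longleftrightarrow> x < c"
| "sat (Less_Test c) (Gap a) \<longleftrightarrow> a < c"

lemma sat_Eq_Test_iff: "sat (Eq_Test c) x \<longleftrightarrow> x = Key c"
  by (cases x) auto

definition side :: "test \<Rightarrow> bool \<Rightarrow> label set \<Rightarrow> label set" where
  "side t s A = {x \<in> A. sat t x = s}"

text \<open>Query-free form of handling, for arbitrary label sets: the labels reaching a subtree
  need not come from a valid set, yet inductions over trees must pass to them.\<close>

fun decides :: "nat \<Rightarrow> tree \<Rightarrow> label set \<Rightarrow> bool" where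
  "decides n (Leaf l) A \<longleftrightarrow> A = {l}"
| "decides n (Node t L R) A \<longleftrightarrow>
     test_key t \<in> {1..n} \<and> decides n L (side t True A) \<and> decides n R (side t False A)"

text \<open>\<open>X\<close> is the subtree for outcome \<open>s\<close> of the test, which treats both orientations of a rotation at once.\<close>

definition branch :: "test \<Rightarrow> bool \<Rightarrow> tree \<Rightarrow> tree \<Rightarrow> tree" where
  "branch t s X Y = (if s then Node t X Y else Node t Y X)"

definition optimal :: "(nat \<Rightarrow> real) \<Rightarrow> (nat \<Rightarrow> real) \<Rightarrow> nat \<Rightarrow> tree \<Rightarrow> label set \<Rightarrow> bool" where
  "optimal \<alpha> \<beta> n T A \<longleftrightarrow>
     decides n T A \<and> (\<forall>T'. decides n T' A \<longrightarrow> cost \<alpha> \<beta> T \<le> cost \<alpha> \<beta> T')"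

definition all_labels :: "nat \<Rightarrow> label set" where
  "all_labels n = Key ` {1..n} \<union> Gap ` {0..n}"

lemma finite_all_labels: "finite (all_labels n)"
  by (simp add: all_labels_def)

lemma side_subset: "side t s A \<subseteq> A"
  by (auto simp: side_def)

lemma finite_side: "finite A \<Longrightarrow> finite (side t s A)"
  by (simp add: side_def)

lemma side_Un: "side t s A \<union> side t (\<not> s) A = A"
  by (auto simp: side_def)

lemma side_Int: "side t s A \<inter> side t (\<not> s) A = {}"
  by (auto simp: side_def)

lemma sum_side:
  fixes w :: "label \<Rightarrow> real"
  assumes "finite A"
  shows "sum w (side t s A) + sum w (side t (\<not> s) A) = sum w A"
  using sum.union_disjoint[OF finite_side[OF assms] finite_side[OF assms] side_Int, of w t s]
  by (simp add: side_Un)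

lemma decides_branch:
  "decides n (branch t s X Y) A \<longleftrightarrow>
     test_key t \<in> {1..n} \<and> decides n X (side t s A) \<and> decides n Y (side t (\<not> s) A)"
  by (auto simp: branch_def)

text \<open>Applied to the two children of a node, this excludes redundant tests: both outcomes
  occur.\<close>

lemma decides_nonempty: "decides n T A \<Longrightarrow> A \<noteq> {}"
  by (induction T arbitrary: A) (auto simp: side_def)

lemma map_fst_leaves_Node:
  "map fst (leaves (Node t L R)) = map fst (leaves L) @ map fst (leaves R)"
  by (simp add: o_def case_prod_unfold)

lemma decides_leaves:
  assumes "decides n T A"
  shows "distinct (map fst (leaves T)) \<and> set (map fst (leaves T)) = A"
  using assms
proof (induction T arbitrary: A)
  case (Leaf l)
  then show ?case by simp
next
  case (Node t L R)
  then have "distinct (map fst (leaves L)) \<and> set (map fst (leaves L)) = side t True A"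
    and "distinct (map fst (leaves R)) \<and> set (map fst (leaves R)) = side t False A"
    by auto
  then show ?case
    unfolding map_fst_leaves_Node using side_Un[of t True A] side_Int[of t True A] by simp
qed

lemma decides_finite: "decides n T A \<Longrightarrow> finite A"
  using decides_leaves by (metis List.finite_set)

lemma sum_leaves_decides:
  assumes "decides n T A"
  shows "(\<Sum>(l, d)\<leftarrow>leaves T. w l) = sum w A"
proof -
  have "(\<Sum>(l, d)\<leftarrow>leaves T. w l) = sum_list (map w (map fst (leaves T)))"
    by (simp add: o_def case_prod_unfold)
  also have "\<dots> = sum w A"
    using decides_leaves[OF assms] by (metis sum_list_distinct_conv_sum_set)
  finally show ?thesis .
qed

section \<open>Cost recursion, optimal subtrees and rotations\<close>

lemma cost_Node_leaves:
  "cost \<alpha> \<beta> (Node t L R) =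
     cost \<alpha> \<beta> L + cost \<alpha> \<beta> R
       + (\<Sum>(l, d)\<leftarrow>leaves L. weight \<alpha> \<beta> l) + (\<Sum>(l, d)\<leftarrow>leaves R. weight \<alpha> \<beta> l)"
proof -
  have "(\<Sum>(l, d)\<leftarrow>map (\<lambda>(x, d). (x, d + 1)) xs. real d * weight \<alpha> \<beta> l) =
        (\<Sum>(l, d)\<leftarrow>xs. real d * weight \<alpha> \<beta> l) + (\<Sum>(l, d)\<leftarrow>xs. weight \<alpha> \<beta> l)"
    for xs :: "(label \<times> nat) list"
    by (induction xs) (auto simp: algebra_simps)
  then show ?thesis by (simp add: cost_def)
qed

lemma cost_branch:
  assumes "decides n (branch t s X Y) A"
  shows "cost \<alpha> \<beta> (branch t s X Y) = cost \<alpha> \<beta> X + cost \<alpha> \<beta> Y + sum (weight \<alpha> \<beta>) A"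
proof -
  have "(\<Sum>(l, d)\<leftarrow>leaves X. weight \<alpha> \<beta> l) = sum (weight \<alpha> \<beta>) (side t s A)"
    "(\<Sum>(l, d)\<leftarrow>leaves Y. weight \<alpha> \<beta> l) = sum (weight \<alpha> \<beta>) (side t (\<not> s) A)"
    using assms sum_leaves_decides by (auto simp: decides_branch)
  then show ?thesis
    using sum_side[OF decides_finite[OF assms], of "weight \<alpha> \<beta>" t s]
    by (cases s) (simp_all add: branch_def cost_Node_leaves)
qed

text \<open>A cheaper subtree could be substituted for \<open>Y\<close>. Because \<open>s\<close> is
  free, this covers both children.\<close>

lemma optimal_child:
  assumes "optimal \<alpha> \<beta> n (branch t s X Y) A"
  shows "optimal \<alpha> \<beta> n Y (side t (\<not> s) A)"
  unfolding optimal_def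
proof (intro conjI allI impI)
  have dec: "decides n (branch t s X Y) A"
    using assms by (simp add: optimal_def)
  then show "decides n Y (side t (\<not> s) A)"
    by (simp add: decides_branch)
  fix Y' assume "decides n Y' (side t (\<not> s) A)"
  with dec have dec': "decides n (branch t s X Y') A"
    by (simp add: decides_branch)
  with assms have "cost \<alpha> \<beta> (branch t s X Y) \<le> cost \<alpha> \<beta> (branch t s X Y')"
    by (simp add: optimal_def)
  then show "cost \<alpha> \<beta> Y \<le> cost \<alpha> \<beta> Y'"
    by (simp add: cost_branch[OF dec] cost_branch[OF dec'])
qed

text \<open>By \<open>opp\<close>, no label of \<open>P\<close> takes outcome \<open>s2\<close> of
  \<open>t2\<close>, so \<open>t2\<close> may be asked first. Then \<open>Q\<close> moves up one
  level, \<open>P\<close> moves down one and \<open>R\<close> keeps its depth: the cost changes by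
  the weight of \<open>P\<close> minus that of \<open>Q\<close>.\<close>

lemma branch_rotate:
  assumes dec: "decides n (branch t1 s1 P (branch t2 s2 Q R)) A"
    and opp: "\<forall>x\<in>side t1 s1 A. sat t2 x \<noteq> s2"
  shows "decides n (branch t2 s2 Q (branch t1 s1 P R)) A" (is ?dec)
    and "cost \<alpha> \<beta> (branch t2 s2 Q (branch t1 s1 P R))
           + sum (weight \<alpha> \<beta>) (side t2 s2 (side t1 (\<not> s1) A)) =
         cost \<alpha> \<beta> (branch t1 s1 P (branch t2 s2 Q R)) + sum (weight \<alpha> \<beta>) (side t1 s1 A)"
proof -
  let ?w = "weight \<alpha> \<beta>"
  let ?C = "side t1 (\<not> s1) A" and ?E = "side t2 (\<not> s2) A"
  \<comment> \<open>Each of \<open>P\<close>, \<open>Q\<close>, \<open>R\<close> receives the same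
    labels before and after the rotation.\<close>
  have eqs: "side t2 s2 ?C = side t2 s2 A" "side t1 s1 ?E = side t1 s1 A"
    "side t1 (\<not> s1) ?E = side t2 (\<not> s2) ?C"
    using opp by (auto simp: side_def)
  show dec': ?dec
    using dec by (simp add: decides_branch eqs)
  have sub: "decides n (branch t2 s2 Q R) ?C" "decides n (branch t1 s1 P R) ?E"
    using dec dec' by (simp_all add: decides_branch)
  have "finite A" using dec by (rule decides_finite)
  then have "sum ?w (side t1 s1 A) + sum ?w ?C = sum ?w A"
    "sum ?w (side t2 s2 A) + sum ?w ?E = sum ?w A"
    by (simp_all add: sum_side)
  then show "cost \<alpha> \<beta> (branch t2 s2 Q (branch t1 s1 P R)) + sum ?w (side t2 s2 ?C) =
      cost \<alpha> \<beta> (branch t1 s1 P (branch t2 s2 Q R)) + sum ?w (side t1 s1 A)"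
    by (simp add: cost_branch[OF dec] cost_branch[OF dec'] cost_branch[OF sub(1)]
        cost_branch[OF sub(2)] eqs)
qed

text \<open>An equality test isolates one label and less-than tests are nested, so one of the four
  outcome combinations of \<open>t1\<close> and \<open>t2\<close> is empty; as \<open>t2\<close>
  splits the labels outside \<open>P\<close>, it must be one inside \<open>P\<close>. The second
  conclusion is the side condition of \<open>root_side_weight\<close>.\<close>

lemma rotatable:
  assumes "decides n (branch t1 s1 P (Node t2 L R)) A"
  obtains s2 where "\<forall>x\<in>side t1 s1 A. sat t2 x \<noteq> s2" and "s2 \<or> (\<exists>d. t2 = Less_Test d)"
proof -
  let ?C = "side t1 (\<not> s1) A"
  from assms have "decides n L (side t2 True ?C)" "decides n R (side t2 False ?C)"
    by (simp_all add: decides_branch)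
  then have "side t2 True ?C \<noteq> {}" "side t2 False ?C \<noteq> {}"
    by (simp_all add: decides_nonempty)
  then obtain y z where y: "y \<in> A" "sat t1 y \<noteq> s1" "sat t2 y"
    and z: "z \<in> A" "sat t1 z \<noteq> s1" "\<not> sat t2 z"
    by (auto simp: side_def)
  show thesis
  proof (cases t2)
    case (Eq_Test c)
    \<comment> \<open>The only label that passes \<open>t2\<close> lies outside \<open>P\<close>, so
      \<open>s2 = True\<close> works.\<close>
    then have "y = Key c" using y(3) by (simp add: sat_Eq_Test_iff)
    then have "\<forall>x\<in>side t1 s1 A. sat t2 x \<noteq> True"
      using y Eq_Test by (auto simp: side_def sat_Eq_Test_iff)
    then show thesis using that by blast
  next
    case (Less_Test e)
    have "\<exists>s2. \<forall>x\<in>side t1 s1 A. sat t2 x \<noteq> s2"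
    proof (cases t1)
      case (Eq_Test c)
      show ?thesis
      proof (cases s1)
        case True
        then have "side t1 s1 A \<subseteq> {Key c}"
          using Eq_Test by (auto simp: side_def sat_Eq_Test_iff)
        then show ?thesis by (intro exI[of _ "\<not> sat t2 (Key c)"]) auto
      next
        case False
        \<comment> \<open>Here at most one key lies outside \<open>P\<close>, and \<open>t2\<close>
          cannot split it.\<close>
        then have "sat t1 y" "sat t1 z" using y(2) z(2) by simp_all
        then have "y = z" using Eq_Test by (simp add: sat_Eq_Test_iff)
        then show ?thesis using y(3) z(3) by simp
      qed
    next
      case (Less_Test d)
      \<comment> \<open>Less-than tests see only this index. As \<open>e\<close> separates
        \<open>y\<close> from \<open>z\<close> while \<open>d\<close> does not, every label of
        \<open>P\<close> answers \<open>t2\<close> as it answers \<open>t1\<close>, with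
        \<open>s1\<close>.\<close>
      define pos where "pos x = (case x of Key c \<Rightarrow> c | Gap a \<Rightarrow> a)" for x
      have pos: "sat (Less_Test c) x \<longleftrightarrow> pos x < c" for c x
        by (cases x) (auto simp: pos_def)
      show ?thesis
        by (rule exI[of _ "\<not> s1"])
          (use y z Less_Test \<open>t2 = Less_Test e\<close> in \<open>auto simp: side_def pos\<close>)
    qed
    then show thesis using that Less_Test by blast
  qed
qed

section \<open>The root of an optimal tree\<close>

lemma weight_nonneg:
  assumes "\<forall>c\<in>{1..n}. 0 \<le> \<beta> c" and "\<forall>a\<in>{0..n}. 0 \<le> \<alpha> a" and "x \<in> all_labels n"
  shows "0 \<le> weight \<alpha> \<beta> x"
  using assms by (auto simp: all_labels_def)

text \<open>Comparisons are strict, so a key and the interval just above it lie on the same side of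
  every pivot. The interval below would be cut off by the less-than test at the key itself.\<close>

lemma sat_Key_eq_Gap: "t \<noteq> Eq_Test b \<Longrightarrow> sat t (Key b) = sat t (Gap b)"
  by (cases t) auto

lemma Node_eq_branch: "\<exists>X Y. Node t L R = branch t s X Y"
  by (cases s) (auto simp: branch_def)

text \<open>
  For an equality test only the positive side is bounded: the negative side of \<open>q = k\<^sub>b\<close> may be as
  light as the interval above \<open>k\<^sub>b\<close>.
\<close>

lemma root_side_weight:
  assumes "optimal \<alpha> \<beta> n (Node t L R) A"
    and "\<forall>x\<in>A. 0 \<le> weight \<alpha> \<beta> x"
    and "Key b \<in> A" and "Gap b \<in> A"
    and "s \<or> (\<exists>d. t = Less_Test d)"
  shows "\<beta> b \<le> sum (weight \<alpha> \<beta>) (side t s A)"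
  using assms
proof (induction "Node t L R" arbitrary: t L R s A rule: measure_induct_rule[where f = size])
  case (less t L R s A)
  have opt: "optimal \<alpha> \<beta> n (Node t L R) A" by fact
  then have dec: "decides n (Node t L R) A" by (simp add: optimal_def)
  show ?case
  proof (cases "sat t (Key b) = s")
    case True
    then have "Key b \<in> side t s A" using less.prems by (simp add: side_def)
    moreover have "finite (side t s A)" using decides_finite[OF dec] by (rule finite_side)
    moreover have "\<forall>x\<in>side t s A. 0 \<le> weight \<alpha> \<beta> x" using less.prems side_subset by blast
    ultimately show ?thesis
      using member_le_sum[of "Key b" "side t s A" "weight \<alpha> \<beta>"] by simp
  next
    case False
    \<comment> \<open>For an equality test \<open>s\<close> is true, and \<open>Key b\<close> would
      take that outcome of \<open>Eq_Test b\<close>.\<close>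
    then have "t \<noteq> Eq_Test b" using less.prems by auto
    then have in_side: "Key b \<in> side t (\<not> s) A" "Gap b \<in> side t (\<not> s) A"
      using False less.prems sat_Key_eq_Gap[of t b] by (auto simp: side_def)
    obtain X Y where XY: "Node t L R = branch t s X Y"
      using Node_eq_branch by blast
    have optY: "optimal \<alpha> \<beta> n Y (side t (\<not> s) A)"
      using opt unfolding XY by (rule optimal_child)
    then have "decides n Y (side t (\<not> s) A)" by (simp add: optimal_def)
    \<comment> \<open>Two distinct labels reach \<open>Y\<close>, so it is not a leaf.\<close>
    with in_side obtain t2 L2 R2 where Y: "Y = Node t2 L2 R2"
      by (cases Y) auto
    obtain s2 where s2: "\<forall>x\<in>side t s A. sat t2 x \<noteq> s2" "s2 \<or> (\<exists>d. t2 = Less_Test d)"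
      using dec unfolding XY Y by (rule rotatable)
    obtain Q R' where QR: "Node t2 L2 R2 = branch t2 s2 Q R'"
      using Node_eq_branch by blast
    have "size (Node t2 L2 R2) < size (Node t L R)"
      unfolding XY Y by (simp add: branch_def)
    then have IH: "\<beta> b \<le> sum (weight \<alpha> \<beta>) (side t2 s2 (side t (\<not> s) A))"
      using less.hyps optY in_side s2(2) less.prems(2) side_subset unfolding Y by blast
    have "decides n (branch t s X (branch t2 s2 Q R')) A"
      using dec unfolding XY Y QR .
    \<comment> \<open>The rotation lifts \<open>Q\<close> and sinks \<open>X\<close>; by optimality
      it saves nothing, so \<open>Q\<close> weighs at most as much as \<open>X\<close>.\<close>
    from branch_rotate(1)[OF this s2(1)] branch_rotate(2)[OF this s2(1), of \<alpha> \<beta>]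
    have "sum (weight \<alpha> \<beta>) (side t2 s2 (side t (\<not> s) A)) \<le> sum (weight \<alpha> \<beta>) (side t s A)"
      using opt unfolding XY Y QR optimal_def by fastforce
    with IH show ?thesis by simp
  qed
qed

text \<open>Ties allow optimal trees with other roots, so the conclusion may provide a tree
  different from \<open>T\<close>, rebuilt from the bottom up.\<close>

lemma optimal_root:
  assumes "optimal \<alpha> \<beta> n T A"
    and "\<forall>x\<in>A. 0 \<le> weight \<alpha> \<beta> x"
    and "Key b \<in> A" and "Gap b \<in> A"
    and "\<forall>c. Key c \<in> A \<longrightarrow> \<beta> c \<le> \<beta> b"
  shows "\<exists>t L R. optimal \<alpha> \<beta> n (Node t L R) A \<and> (t = Eq_Test b \<or> (\<exists>d. t = Less_Test d))"
  using assms
proof (induction T arbitrary: A)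
  case (Leaf l)
  then show ?case by (auto simp: optimal_def)
next
  case (Node t X Y)
  show ?case
  proof (cases "t = Eq_Test b \<or> (\<exists>d. t = Less_Test d)")
    case True
    then show ?thesis using Node.prems by blast
  next
    case False
    then obtain c where t: "t = Eq_Test c" "c \<noteq> b" by (cases t) auto
    let ?C = "side t False A"
    have opt: "optimal \<alpha> \<beta> n (branch t True X Y) A"
      using Node.prems by (simp add: branch_def)
    then have dec: "decides n (branch t True X Y) A" by (simp add: optimal_def)
    have optY: "optimal \<alpha> \<beta> n Y ?C" using optimal_child[OF opt] by simp
    \<comment> \<open>Only \<open>Key c\<close> has been split off, and
      \<open>c \<noteq> b\<close>.\<close>
    have C: "\<forall>x\<in>?C. 0 \<le> weight \<alpha> \<beta> x" "Key b \<in> ?C" "Gap b \<in> ?C"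
      "\<forall>c. Key c \<in> ?C \<longrightarrow> \<beta> c \<le> \<beta> b"
      using Node.prems t by (auto simp: side_def)
    obtain t2 L R where opt2: "optimal \<alpha> \<beta> n (Node t2 L R) ?C"
      and t2: "t2 = Eq_Test b \<or> (\<exists>d. t2 = Less_Test d)"
      using Node.IH(2)[OF optY C] by blast
    have dec2: "decides n (branch t True X (Node t2 L R)) A"
      using dec opt2 by (simp add: decides_branch optimal_def)
    have cost2: "cost \<alpha> \<beta> (branch t True X (Node t2 L R)) \<le> cost \<alpha> \<beta> (branch t True X Y)"
      using dec opt2 by (simp add: cost_branch[OF dec] cost_branch[OF dec2])
        (simp add: decides_branch optimal_def)
    obtain s2 where s2: "\<forall>x\<in>side t True A. sat t2 x \<noteq> s2" "s2 \<or> (\<exists>d. t2 = Less_Test d)"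
      using dec2 by (rule rotatable)
    obtain Q R' where QR: "Node t2 L R = branch t2 s2 Q R'"
      using Node_eq_branch by blast
    have "side t True A \<noteq> {}"
      using dec decides_nonempty by (auto simp: decides_branch)
    moreover have "side t True A \<subseteq> {Key c}"
      using t by (auto simp: side_def sat_Eq_Test_iff)
    ultimately have Kc: "side t True A = {Key c}" by blast
    then have "Key c \<in> A" using side_subset by blast
    then have "\<beta> c \<le> \<beta> b" using Node.prems by blast
    also have "\<beta> b \<le> sum (weight \<alpha> \<beta>) (side t2 s2 ?C)"
      by (rule root_side_weight[OF opt2 C(1-3) s2(2)])
    finally have le: "sum (weight \<alpha> \<beta>) (side t True A) \<le> sum (weight \<alpha> \<beta>) (side t2 s2 ?C)"
      using Kc by simp
    let ?T = "branch t2 s2 Q (branch t True X R')"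
    note rot = branch_rotate(1)[OF dec2[unfolded QR] s2(1)]
      branch_rotate(2)[OF dec2[unfolded QR] s2(1), of \<alpha> \<beta>]
    \<comment> \<open>The rotation sinks \<open>Key c\<close> and lifts a side at least as heavy;
      \<open>t2\<close> becomes the root.\<close>
    have "cost \<alpha> \<beta> ?T \<le> cost \<alpha> \<beta> (branch t True X Y)"
      using rot(2) le cost2 unfolding QR by simp
    then have "optimal \<alpha> \<beta> n ?T A"
      using rot(1) opt unfolding optimal_def by force
    then show ?thesis
      using t2 by (cases s2) (auto simp: branch_def)
  qed
qed

section \<open>Existence of optimal trees\<close>

lemma card_side_less:
  assumes "finite A" and "side t (\<not> s) A \<noteq> {}"
  shows "card (side t s A) < card A"
  using assms by (intro psubset_card_mono) (auto simp: side_def)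

lemma decides_exists:
  assumes "A \<subseteq> all_labels n" and "A \<noteq> {}"
  shows "\<exists>T. decides n T A"
  using assms
proof (induction "card A" arbitrary: A rule: less_induct)
  case less
  have fin: "finite A" using less.prems finite_all_labels finite_subset by blast
  show ?case
  proof (cases "\<exists>l. A = {l}")
    case True
    then show ?thesis by (metis decides.simps(1))
  next
    case False
    then obtain x y where xy: "x \<in> A" "y \<in> A" "x \<noteq> y"
      using less.prems(2) by blast
    have "\<exists>t. test_key t \<in> {1..n} \<and> side t True A \<noteq> {} \<and> side t False A \<noteq> {}"
    proof (cases "\<exists>c. Key c \<in> A")
      case True
      then obtain c where c: "Key c \<in> A" by blast
      obtain z where "z \<in> A" "z \<noteq> Key c" using xy by blast
      then have "\<not> sat (Eq_Test c) z" by (cases z) auto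
      with c \<open>z \<in> A\<close> less.prems(1) show ?thesis
        by (intro exI[of _ "Eq_Test c"]) (auto simp: side_def all_labels_def)
    next
      case no_key: False
      then obtain i j where "Gap i \<in> A" "Gap j \<in> A" "i < j"
        using xy by (metis label.exhaust linorder_neqE_nat)
      \<comment> \<open>The pivot is the lower end of interval \<open>j\<close>; from
        \<open>i < j\<close> and \<open>j \<le> n\<close> it is a proper key, not a
        sentinel.\<close>
      with less.prems(1) show ?thesis
        by (intro exI[of _ "Less_Test j"]) (fastforce simp: side_def all_labels_def)
    qed
    then obtain t where t: "test_key t \<in> {1..n}" "side t True A \<noteq> {}" "side t False A \<noteq> {}"
      by blast
    have "\<exists>T. decides n T (side t s A)" for s
      using t less.prems(1) side_subset[of t s A]
      by (intro less.hyps card_side_less[OF fin]) (cases s; auto)+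
    then show ?thesis using t(1) by (meson decides.simps(2))
  qed
qed

text \<open>Ensures that the minimum cost is attained. Every test splits its label set properly, so
  the sets shrink along each path.\<close>

lemma finite_decides: "finite {T. decides n T A}"
proof (cases "finite A")
  case False
  then have "{T. decides n T A} = {}" using decides_finite by blast
  then show ?thesis by simp
next
  case True
  then show ?thesis
  proof (induction "card A" arbitrary: A rule: less_induct)
    case less
    define ts where "ts = {t \<in> Eq_Test ` {1..n} \<union> Less_Test ` {1..n}.
      side t True A \<noteq> {} \<and> side t False A \<noteq> {}}"
    let ?sub = "\<lambda>t s. {T. decides n T (side t s A)}"
    have "finite ts" by (simp add: ts_def)
    moreover have "finite (?sub t s)" if "t \<in> ts" for t s
      using that less.prems
      by (intro less.hyps card_side_less finite_side) (cases s; auto simp: ts_def)+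
    \<comment> \<open>\<open>the_elem A\<close> is the only possible leaf label if \<open>A\<close>
      is a singleton; otherwise the extra leaf is harmless in a superset.\<close>
    ultimately have
      "finite ({Leaf (the_elem A)} \<union> (\<Union>t\<in>ts. case_prod (Node t) ` (?sub t True \<times> ?sub t False)))"
      by auto
    moreover have "{T. decides n T A} \<subseteq>
      {Leaf (the_elem A)} \<union> (\<Union>t\<in>ts. case_prod (Node t) ` (?sub t True \<times> ?sub t False))"
    proof
      fix T assume "T \<in> {T. decides n T A}"
      then have T: "decides n T A" by simp
      show "T \<in> {Leaf (the_elem A)}
        \<union> (\<Union>t\<in>ts. case_prod (Node t) ` (?sub t True \<times> ?sub t False))"
      proof (cases T)
        case (Leaf l)
        then show ?thesis using T by simp
      next
        case (Node t L R)
        then have "t \<in> ts"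
          using T decides_nonempty by (cases t) (auto simp: ts_def)
        then show ?thesis using T Node by force
      qed
    qed
    ultimately show ?case by (rule rev_finite_subset)
  qed
qed

lemma optimal_exists:
  assumes "A \<subseteq> all_labels n" and "A \<noteq> {}"
  shows "\<exists>T. optimal \<alpha> \<beta> n T A"
proof -
  have "{T. decides n T A} \<noteq> {}" using decides_exists[OF assms] by simp
  from ex_min_if_finite[of "cost \<alpha> \<beta> ` {T. decides n T A}"] this finite_decides[of n A]
  obtain T where "decides n T A" "\<forall>T'. decides n T' A \<longrightarrow> \<not> cost \<alpha> \<beta> T' < cost \<alpha> \<beta> T"
    by auto
  then show ?thesis by (auto simp: optimal_def not_less)
qed

section \<open>Labels as sets of real queries\<close>

fun points :: "(nat \<Rightarrow> real) \<Rightarrow> nat \<Rightarrow> label \<Rightarrow> ereal set" where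
  "points k n (Key c) = {key k n c}"
| "points k n (Gap a) = failure_interval k n a"

lemma key_less_iff:
  assumes "strict_mono_on {1..n} k" and "i \<le> n + 1" and "j \<le> n + 1"
  shows "key k n i < key k n j \<longleftrightarrow> i < j"
proof -
  have "key k n i < key k n j" if "i < j" "j \<le> n + 1" for i j
    using that strict_mono_onD[OF assms(1), of i j] by (auto simp: key_def)
  then show ?thesis
    using assms(2,3) by (metis less_asym linorder_neqE_nat order_less_irrefl)
qed

lemma key_le_iff:
  assumes "strict_mono_on {1..n} k" and "i \<le> n + 1" and "j \<le> n + 1"
  shows "key k n i \<le> key k n j \<longleftrightarrow> i \<le> j"
  using key_less_iff[OF assms(1,3,2)] by (simp add: not_less[symmetric])

lemma key_eq_iff:
  assumes "strict_mono_on {1..n} k" and "i \<le> n + 1" and "j \<le> n + 1"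
  shows "key k n i = key k n j \<longleftrightarrow> i = j"
  using key_less_iff[OF assms] key_less_iff[OF assms(1,3,2)]
  by (metis linorder_neqE_nat order_less_irrefl)

lemma failure_interval_nonempty:
  assumes "strict_mono_on {1..n} k" and "a \<le> n"
  shows "failure_interval k n a \<noteq> {}"
  using dense[of "key k n a" "key k n (a + 1)"] key_less_iff[OF assms(1), of a "a + 1"] assms(2)
  by (auto simp: failure_interval_def)

lemma failure_interval_less_key_iff:
  assumes "strict_mono_on {1..n} k" and "a \<le> n" and "d \<le> n + 1"
    and "q \<in> failure_interval k n a"
  shows "q < key k n d \<longleftrightarrow> a < d"
proof (cases "a < d")
  case True
  then have "key k n (a + 1) \<le> key k n d" using assms by (simp add: key_le_iff)
  then show ?thesis using assms(4) True by (auto simp: failure_interval_def)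
next
  case False
  then have "key k n d \<le> key k n a" using assms by (simp add: key_le_iff)
  then show ?thesis using assms(4) False by (auto simp: failure_interval_def)
qed

lemma key_notin_failure_interval:
  assumes "strict_mono_on {1..n} k" and "a \<le> n" and "d \<le> n + 1"
  shows "key k n d \<notin> failure_interval k n a"
  using assms key_less_iff[of n k a d] key_less_iff[of n k d "a + 1"]
  by (auto simp: failure_interval_def)

text \<open>All queries of one label answer alike, because no key lies inside a failure interval;
  interval \<open>a\<close> has upper end \<open>a + 1\<close>, so it is below key \<open>c\<close>
  exactly if \<open>a < c\<close>.\<close>

lemma test_holds_iff_sat:
  assumes "strict_mono_on {1..n} k" and "test_key t \<in> {1..n}"
    and "l \<in> all_labels n" and "q \<in> points k n l"
  shows "test_holds k n t q \<longleftrightarrow> sat t l"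
proof (cases l)
  case (Key c)
  then show ?thesis
    using assms by (cases t) (auto simp: all_labels_def key_eq_iff key_less_iff)
next
  case (Gap a)
  then have "a \<le> n" "q \<in> failure_interval k n a" using assms by (auto simp: all_labels_def)
  then show ?thesis
    using Gap assms(1,2) failure_interval_less_key_iff[of n k a "test_key t" q]
      key_notin_failure_interval[of n k a "test_key t"]
    by (cases t) auto
qed

lemma decides_search:
  assumes "strict_mono_on {1..n} k" and "decides n T A" and "A \<subseteq> all_labels n"
    and "l \<in> A" and "q \<in> points k n l"
  shows "search k n T q = l"
  using assms(2-4)
proof (induction T arbitrary: A)
  case (Leaf x)
  then show ?case by simp
next
  case (Node t L R)
  then have hold: "test_holds k n t q \<longleftrightarrow> sat t l"
    using assms by (intro test_holds_iff_sat) auto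
  show ?case
  proof (cases "sat t l")
    case True
    then have "l \<in> side t True A" using Node.prems by (simp add: side_def)
    then show ?thesis
      using Node.IH(1)[of "side t True A"] Node.prems side_subset[of t True A] True hold by auto
  next
    case False
    then have "l \<in> side t False A" using Node.prems by (simp add: side_def)
    then show ?thesis
      using Node.IH(2)[of "side t False A"] Node.prems side_subset[of t False A] False hold by auto
  qed
qed

lemma two_way_tree_of_decides:
  "decides n T A \<Longrightarrow> A \<subseteq> all_labels n \<Longrightarrow> two_way_tree n T"
proof (induction T arbitrary: A)
  case (Leaf l)
  then show ?case by (auto simp: all_labels_def)
next
  case (Node t L R)
  then show ?case
    using side_subset[of t True A] side_subset[of t False A]
    by (meson decides.simps(2) order_trans two_way_tree.simps(2))
qed

text \<open>One query per label suffices: its search ends at a leaf of the child chosen by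
  \<open>sat\<close>, so each side is contained in the leaf labels of its child. These are disjoint
  and cover \<open>A\<close>, which turns the inclusions into equalities.\<close>

lemma decides_of_search:
  assumes "strict_mono_on {1..n} k" and "two_way_tree n T"
    and "distinct (map fst (leaves T))" and "set (map fst (leaves T)) = A"
    and "A \<subseteq> all_labels n"
    and "\<forall>l\<in>A. \<exists>q\<in>points k n l. search k n T q = l"
  shows "decides n T A"
  using assms(2-6)
proof (induction T arbitrary: A)
  case (Leaf l)
  then show ?case by simp
next
  case (Node t L R)
  have search_leaf: "search k n T q \<in> set (map fst (leaves T))" for T q
    by (induction T) (simp_all add: map_fst_leaves_Node del: leaves.simps(2) set_map)
  let ?L = "set (map fst (leaves L))" and ?R = "set (map fst (leaves R))"
  have A: "A = ?L \<union> ?R" "?L \<inter> ?R = {}"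
    "distinct (map fst (leaves L))" "distinct (map fst (leaves R))"
    using Node.prems(2,3) unfolding map_fst_leaves_Node by auto
  have tk: "test_key t \<in> {1..n}" "two_way_tree n L" "two_way_tree n R"
    using Node.prems(1) by auto
  have search: "\<exists>q\<in>points k n l. search k n (if sat t l then L else R) q = l" if l: "l \<in> A" for l
  proof -
    obtain q where q: "q \<in> points k n l" "search k n (Node t L R) q = l"
      using bspec[OF Node.prems(5) l] by blast
    have "test_holds k n t q \<longleftrightarrow> sat t l"
      using assms(1) tk(1) q(1) Node.prems(4) l by (intro test_holds_iff_sat) auto
    then show ?thesis using q by auto
  qed
  have "l \<in> ?L" if "l \<in> A" "sat t l" for l
    using search[OF that(1)] search_leaf[of L] that(2) by fastforce
  moreover have "l \<in> ?R" if "l \<in> A" "\<not> sat t l" for l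
    using search[OF that(1)] search_leaf[of R] that(2) by fastforce
  ultimately have eq: "?L = side t True A" "?R = side t False A"
    using A(1,2) unfolding side_def by blast+
  have found: "\<forall>l\<in>side t True A. \<exists>q\<in>points k n l. search k n L q = l"
    "\<forall>l\<in>side t False A. \<exists>q\<in>points k n l. search k n R q = l"
    using search by (fastforce simp: side_def)+
  have sub: "side t s A \<subseteq> all_labels n" for s
    using Node.prems(4) side_subset by blast
  show ?case
    using tk(1) Node.IH(1)[OF tk(2) A(3) eq(1) sub found(1)]
      Node.IH(2)[OF tk(3) A(4) eq(2) sub found(2)] by simp
qed

section \<open>Valid sets and their labels\<close>

lemma labels_of_subset: "labels_of k n S \<subseteq> all_labels n"
  by (auto simp: labels_of_def all_labels_def)

text \<open>Only keys and the lower sentinel are removed from the range, and an open interval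
  between neighbours contains none of them.\<close>

lemma failure_interval_subset_S_ijh:
  assumes "strict_mono_on {1..n} k" and "\<pi> permutes {1..n}"
    and "i \<le> a" and "a < j" and "j \<le> n + 1"
  shows "failure_interval k n a \<subseteq> S_ijh k n \<pi> i j h"
proof
  fix q assume q: "q \<in> failure_interval k n a"
  have a: "a \<le> n" using assms(4,5) by simp
  note less_iff = failure_interval_less_key_iff[OF assms(1) a _ q]
  have ne: "q \<noteq> key k n d" if "d \<le> n + 1" for d
    using key_notin_failure_interval[OF assms(1) a that] q by blast
  have "\<pi> m \<le> n + 1" if "m \<in> {h + 1..n}" for m
    using permutes_in_image[OF assms(2), of m] that by auto
  then have "q \<notin> {key k n (\<pi> m) | m. m \<in> {h + 1..n}} \<union> {key k n 0}"
    using ne by blast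
  moreover have "key k n i \<le> q" using less_iff[of i] assms(3) a by (simp add: not_less[symmetric])
  moreover have "q < key k n j" using less_iff[of j] assms(4,5) by simp
  ultimately show "q \<in> S_ijh k n \<pi> i j h" by (simp add: S_ijh_def)
qed

text \<open>Guarantees that a query of \<open>S\<close> inside an interval has its label in
  \<open>labels_of\<close>, which records only the intervals wholly contained in
  \<open>S\<close>.\<close>

lemma valid_failure_interval:
  assumes "strict_mono_on {1..n} k" and "\<pi> permutes {1..n}" and "valid k n \<pi> S"
    and "a \<le> n" and "q \<in> S" and "q \<in> failure_interval k n a"
  shows "failure_interval k n a \<subseteq> S"
proof -
  have "\<not> (\<exists>b\<in>{1..n}. S = {key k n b})"
    using assms(1,4-6) key_notin_failure_interval by fastforce
  then obtain i j h where ij: "i \<le> n + 1" "j \<le> n + 1" and S: "S = S_ijh k n \<pi> i j h"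
    using assms(3) unfolding valid_def by (metis atLeastAtMost_iff)
  have "key k n i \<le> q" "q < key k n j" using S assms(5) by (auto simp: S_ijh_def)
  then have "i \<le> a" "a < j"
    using failure_interval_less_key_iff[OF assms(1,4) _ assms(6)] ij
    by (auto simp: not_less[symmetric])
  then show ?thesis
    unfolding S using assms(1,2) ij(2) by (intro failure_interval_subset_S_ijh)
qed

text \<open>The range is open at its upper end \<open>j\<close>, so \<open>b < j\<close> and the
  range extends at least to the next key or sentinel.\<close>

lemma valid_gap_above_key:
  assumes "strict_mono_on {1..n} k" and "\<pi> permutes {1..n}" and "valid k n \<pi> S"
    and "b \<in> {1..n}" and "key k n b \<in> S" and "S \<noteq> {key k n b}"
  shows "failure_interval k n b \<subseteq> S"
proof -
  have "\<not> (\<exists>c\<in>{1..n}. S = {key k n c})"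
    using assms(5,6) by auto
  then obtain i j h where ij: "i \<le> n + 1" "j \<le> n + 1" and S: "S = S_ijh k n \<pi> i j h"
    using assms(3) unfolding valid_def by (metis atLeastAtMost_iff)
  have "key k n i \<le> key k n b" "key k n b < key k n j" using S assms(5) by (auto simp: S_ijh_def)
  then have "i \<le> b" "b < j" using assms(1,4) ij by (auto simp: key_le_iff key_less_iff)
  then show ?thesis
    unfolding S using assms(1,2) ij(2) by (intro failure_interval_subset_S_ijh)
qed

text \<open>Makes the competing trees of the theorem the same as those in
  \<open>optimal\<close>.\<close>

lemma handles_iff_decides:
  assumes "strict_mono_on {1..n} k" and "\<pi> permutes {1..n}" and "valid k n \<pi> S"
  shows "two_way_tree n T \<and> handles k n T S \<longleftrightarrow> decides n T (labels_of k n S)"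
proof
  assume T: "two_way_tree n T \<and> handles k n T S"
  have "\<exists>q\<in>points k n l. search k n T q = l" if "l \<in> labels_of k n S" for l
  proof (cases l)
    case (Key c)
    then show ?thesis using T that by (auto simp: handles_def labels_of_def)
  next
    case (Gap a)
    then have a: "a \<in> {0..n}" "failure_interval k n a \<subseteq> S"
      using that by (auto simp: labels_of_def)
    then obtain q where "q \<in> failure_interval k n a"
      using failure_interval_nonempty[OF assms(1)] by fastforce
    then show ?thesis
      using T Gap a unfolding handles_def by (metis points.simps(2) subsetD)
  qed
  then show "decides n T (labels_of k n S)"
    using T by (intro decides_of_search[OF assms(1)] labels_of_subset) (auto simp: handles_def)
next
  assume T: "decides n T (labels_of k n S)"
  have search: "search k n T q = l" if "l \<in> labels_of k n S" "q \<in> points k n l" for l q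
    using decides_search[OF assms(1) T labels_of_subset that] .
  have "search k n T q = Key c" if "q \<in> S" "c \<in> {1..n}" "q = key k n c" for q c
    using that by (intro search) (auto simp: labels_of_def)
  moreover have "search k n T q = Gap a"
    if "q \<in> S" "a \<in> {0..n}" "q \<in> failure_interval k n a" for q a
    using that valid_failure_interval[OF assms, of a q]
    by (intro search) (auto simp: labels_of_def)
  ultimately show "two_way_tree n T \<and> handles k n T S"
    using decides_leaves[OF T] two_way_tree_of_decides[OF T labels_of_subset]
    unfolding handles_def by blast
qed

theorem theorem1:
  fixes n :: nat and k \<alpha> \<beta> :: "nat \<Rightarrow> real" and \<pi> :: "nat \<Rightarrow> nat"
    and S :: "ereal set" and b :: nat
  assumes "strict_mono_on {1..n} k"
    and "\<forall>c\<in>{1..n}. 0 \<le> \<beta> c"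
    and "\<forall>a\<in>{0..n}. 0 \<le> \<alpha> a"
    and "\<pi> permutes {1..n}"
    and "mono_on {1..n} (\<lambda>h. \<beta> (\<pi> h))"
    and "valid k n \<pi> S"
    and "b \<in> {1..n}" and "key k n b \<in> S"
    and "\<forall>c\<in>{1..n}. key k n c \<in> S \<longrightarrow> \<beta> c \<le> \<beta> b"
  shows "\<exists>T. two_way_tree n T \<and> handles k n T S \<and>
    (\<forall>T'. two_way_tree n T' \<and> handles k n T' S \<longrightarrow> cost \<alpha> \<beta> T \<le> cost \<alpha> \<beta> T') \<and>
    ((\<exists>l. T = Leaf l) \<or>
     (\<exists>c\<in>{1..n}. \<exists>l r. T = Node (Less_Test c) l r) \<or>
     (\<exists>l r. T = Node (Eq_Test b) l r))"
proof -
  let ?A = "labels_of k n S"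
  note handles = handles_iff_decides[OF assms(1,4,6)]
  have Kb: "Key b \<in> ?A" using assms(7,8) by (simp add: labels_of_def)
  obtain T where T: "optimal \<alpha> \<beta> n T ?A"
    using optimal_exists[OF labels_of_subset] Kb by blast
  have "\<exists>T. optimal \<alpha> \<beta> n T ?A \<and>
    ((\<exists>l. T = Leaf l) \<or> (\<exists>c l r. T = Node (Less_Test c) l r) \<or> (\<exists>l r. T = Node (Eq_Test b) l r))"
  proof (cases "Gap b \<in> ?A")
    case True
    have "\<forall>x\<in>?A. 0 \<le> weight \<alpha> \<beta> x"
      using weight_nonneg[OF assms(2,3)] labels_of_subset by blast
    moreover have "\<forall>c. Key c \<in> ?A \<longrightarrow> \<beta> c \<le> \<beta> b"
      using assms(9) by (auto simp: labels_of_def)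
    ultimately show ?thesis
      using optimal_root[OF T _ Kb True] by blast
  next
    case False
    then have S: "S = {key k n b}"
      using valid_gap_above_key[OF assms(1,4,6,7,8)] assms(7) by (auto simp: labels_of_def)
    \<comment> \<open>A nonempty interval that avoids \<open>key k n b\<close> does not fit into
      this singleton; hence \<open>Key b\<close> is the only label.\<close>
    have "\<not> failure_interval k n a \<subseteq> S" if "a \<le> n" for a
      using failure_interval_nonempty[OF assms(1) that]
        key_notin_failure_interval[OF assms(1) that, of b] assms(7) S by auto
    then have "?A = {Key b}"
      using Kb assms(1,7) S by (auto simp: labels_of_def key_eq_iff)
    then have T': "decides n T {Key b}" using T by (simp add: optimal_def)
    have "\<exists>l. T = Leaf l"
    proof (cases T)
      case (Node t L R)
      \<comment> \<open>An inner node would split a single label into two nonempty sides.\<close>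
      then have "side t True {Key b} \<noteq> {}" "side t False {Key b} \<noteq> {}"
        using T' decides_nonempty by (meson decides.simps(2))+
      then show ?thesis by (auto simp: side_def)
    qed simp
    then show ?thesis using T by blast
  qed
  \<comment> \<open>That the pivot \<open>c\<close> lies in \<open>{1..n}\<close> is part of
    \<open>decides\<close>.\<close>
  then show ?thesis
    unfolding optimal_def handles[symmetric] by fastforce
qed

end
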